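(* Let $p$ be a prime with $p\equiv 2$ or $3\pmod 5$ and let $r$ be a positive integer. Then the rank-metric code $\phi_O(\mathbb{F}_{p^2}^r)\subseteq M_{2\times 2r}(\mathbb{F}_p)$ attains the Singleton bound for rank-metric codes (i.e. it is a maximum rank distance code): if $\rho$ denotes its dimension over $\mathbb{F}_p$ and $\delta$ its minimum rank distance, then $$\rho=\min\{2(2r-\delta+1),\ 2r(2-\delta+1)\}.$$
   Context: Fix $\omega \in \mathbb{F}_{p^2}$ such that $\{1,\omega\}$ is an $\mathbb{F}_p$-basis of $\mathbb{F}_{p^2}$. The map $\phi_O:\mathbb{F}_{p^2}^r\to M_{2\times 2r}(\mathbb{F}_p)$ is defined, for $c_i,d_i\in\mathbb{F}_p$, by $$\phi_O((c_1+d_1\omega,\dots,c_r+d_r\omega))=\begin{pmatrix} d_1&c_1&d_2&c_2&\cdots&d_r&c_r\\ c_1+d_1&d_1&c_2+d_2&d_2&\cdots&c_r+d_r&d_r\end{pmatrix}.$$ The rank distance on $M_{k\times\ell}(\mathbb{F}_q)$ is $d_R(A,B)=\operatorname{rank}(A-B)$. A $[k\times\ell,\rho,\delta]$ rank-metric code over $\mathbb{F}_q$ is an $\mathbb{F}_q$-linear subspace of $M_{k\times\ell}(\mathbb{F}_q)$ of dimension $\rho$ with minimum rank distance $\delta$ between distinct elements. The Singleton bound says that any such code satisfies $\rho\le\min\{k(\ell-\delta+1),\ell(k-\delta+1)\}$; a code attaining equality is called a maximum rank distance (MRD) code. *)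

theory Defs
  imports
    "HOL-Number_Theory.Cong"
    "Jordan_Normal_Form.DL_Rank"
    "Berlekamp_Zassenhaus.Finite_Field"
begin

definition rank_dist :: "'a::field mat \<Rightarrow> 'a mat \<Rightarrow> nat" where
  "rank_dist A B = vec_space.rank (dim_row A) (A - B)"

definition is_min_rank_dist :: "'a::field mat set \<Rightarrow> nat \<Rightarrow> bool" where
  "is_min_rank_dist C \<delta> \<longleftrightarrow>
     (\<exists>A\<in>C. \<exists>B\<in>C. A \<noteq> B \<and> rank_dist A B = \<delta>) \<and>
     (\<forall>A\<in>C. \<forall>B\<in>C. A \<noteq> B \<longrightarrow> \<delta> \<le> rank_dist A B)"

definition rank_metric_code :: "nat \<Rightarrow> nat \<Rightarrow> nat \<Rightarrow> nat \<Rightarrow> 'a::field mat set \<Rightarrow> bool" where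
  "rank_metric_code k l \<rho> \<delta> C \<longleftrightarrow>
     VectorSpace.subspace class_ring C (module_mat TYPE('a) k l) \<and>
     vectorspace.dim class_ring ((module_mat TYPE('a) k l)\<lparr>carrier := C\<rparr>) = \<rho> \<and>
     is_min_rank_dist C \<delta>"

text \<open>The parameters \<open>\<rho>\<close> and \<open>\<delta>\<close> are determined by the code. The equation is stated in the
  integers because the differences would be truncated in the natural numbers.\<close>

definition mrd_code :: "nat \<Rightarrow> nat \<Rightarrow> 'a::field mat set \<Rightarrow> bool" where
  "mrd_code k l C \<longleftrightarrow>
     (\<exists>\<rho> \<delta>. rank_metric_code k l \<rho> \<delta> C \<and>
        int \<rho> = min (int k * (int l - int \<delta> + 1)) (int l * (int k - int \<delta> + 1)))"

text \<open>The prime field is \<^typ>\<open>'p::prime_card mod_ring\<close>. In a field \<open>'k\<close> of characteristic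
  \<^term>\<open>CARD('p)\<close> it has exactly one embedding, which sends a residue class to the image
  of any integer representing it.\<close>

definition emb :: "'p::prime_card mod_ring \<Rightarrow> 'k::field" where
  "emb c = of_int (to_int_mod_ring c)"

definition ext_scale :: "'p::prime_card mod_ring \<Rightarrow> 'k::field \<Rightarrow> 'k" where
  "ext_scale c x = emb c * x"

definition is_ext_basis :: "'p::prime_card itself \<Rightarrow> 'k::field set \<Rightarrow> bool" where
  "is_ext_basis _ B \<longleftrightarrow>
     \<not> Modules.module.dependent (ext_scale :: 'p mod_ring \<Rightarrow> 'k \<Rightarrow> 'k) B \<and>
     Modules.module.span (ext_scale :: 'p mod_ring \<Rightarrow> 'k \<Rightarrow> 'k) B = UNIV"

text \<open>\<open>coord \<omega> b x\<close> is the coefficient of the basis vector \<open>b\<close> when \<open>x\<close> is written in the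
  basis \<open>{1, \<omega>}\<close>: if \<open>x = c + d\<omega>\<close>, then \<open>c = coord \<omega> 1 x\<close> and \<open>d = coord \<omega> \<omega> x\<close>.\<close>

definition coord :: "'k::field \<Rightarrow> 'k \<Rightarrow> 'k \<Rightarrow> 'p::prime_card mod_ring" where
  "coord \<omega> b x = Modules.module.representation ext_scale {1, \<omega>} x b"

text \<open>Rows and columns are numbered from 0, so the component with index \<open>t\<close> occupies the
  columns \<open>2 * t\<close> and \<open>2 * t + 1\<close>.\<close>

definition phi_O :: "'k::field \<Rightarrow> 'k vec \<Rightarrow> 'p::prime_card mod_ring mat" where
  "phi_O \<omega> x = mat 2 (2 * dim_vec x) (\<lambda>(i, j).
     let c = coord \<omega> 1 (x $ (j div 2)); d = coord \<omega> \<omega> (x $ (j div 2))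
     in if i = 0 then (if even j then d else c)
        else (if even j then c + d else d))"

end

(* The code is the image of the vectors v = (d_1, c_1, ..., d_r, c_r) under an injective linear map,
   whose value has v as its top row, so its dimension is 2r. A block (d, c; c + d, d) has
   determinant d^2 - cd - c^2; for (c, d) nonzero this vanishes only if d / c is a root of
   X^2 - X - 1, whose discriminant 5 is not a square mod p when p = 2 or 3 mod 5 (and which has no
   root mod 2). Hence every nonzero codeword has rank 2, so delta = 2 and rho = 2r. *)

theory Submission
  imports Defs "HOL-Number_Theory.Quadratic_Reciprocity"
begin

section \<open>Roots of X^2 - X - 1 modulo p\<close>

lemma not_QuadRes_5:
  fixes p :: nat
  assumes "prime p" "p > 2" and p5: "[p = 2] (mod 5) \<or> [p = 3] (mod 5)"
  shows "\<not> QuadRes (int p) 5"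
proof
  assume Q: "QuadRes (int p) 5"
  have p_mod: "p mod 5 = 2 \<or> p mod 5 = 3"
    using p5 by (simp add: cong_def)
  \<comment> \<open>This excludes the value 0 of \<open>Legendre 5 (int p)\<close>, and reciprocity
    is about distinct primes.\<close>
  then have "p \<noteq> 5" by auto
  have prime_5: "prime (5::nat)" by simp
  then have "\<not> p dvd 5"
    using \<open>p \<noteq> 5\<close> primes_dvd_imp_eq[OF \<open>prime p\<close>] by blast
  then have "\<not> int p dvd 5"
    by (metis int_dvd_int_iff of_nat_numeral)
  then have "\<not> [(5::int) = 0] (mod int p)"
    by (simp add: cong_0_iff)
  then have L1: "Legendre 5 (int p) = 1"
    using Q by (simp add: Legendre_def)
  have "Legendre (int p) (int 5) * Legendre (int 5) (int p)
      = (-1) ^ ((p - 1) div 2 * ((5 - 1) div 2))"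
    using \<open>prime p\<close> \<open>p > 2\<close> \<open>p \<noteq> 5\<close> prime_5 by (intro Quadratic_Reciprocity) auto
  \<comment> \<open>The factor \<open>(5 - 1) div 2 = 2\<close> makes the exponent even.\<close>
  also have "\<dots> = 1" by (simp add: power_mult mult.commute[of _ 2])
  finally have "Legendre (int p) 5 = 1" using L1 by simp
  then have "QuadRes 5 (int p)"
    by (simp add: Legendre_def split: if_splits)
  then obtain y where y: "[y^2 = int p] (mod 5)"
    by (auto simp: QuadRes_def)
  then have "(y mod 5)^2 mod 5 = int p mod 5"
    by (simp add: cong_def power_mod)
  \<comment> \<open>The squares modulo 5 are 0, 1 and 4, so neither 2 nor 3 occurs.\<close>
  moreover have "y mod 5 \<in> {0, 1, 2, 3, 4}" by auto
  moreover have "int p mod 5 = 2 \<or> int p mod 5 = 3"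
    using p_mod by presburger
  ultimately show False by auto
qed

text \<open>For odd p, completing the square turns a root into a square root of 5 modulo p. For p =
  2 the value is odd, since \<open>u * u - u\<close> is even.\<close>

lemma golden_poly_no_root_mod:
  fixes p :: nat and u :: int
  assumes "prime p" and p5: "[p = 2] (mod 5) \<or> [p = 3] (mod 5)"
  shows "\<not> int p dvd u * u - u - 1"
proof
  assume dvd: "int p dvd u * u - u - 1"
  show False
  proof (cases "p = 2")
    case True
    then have "even (u * u - u - 1)" using dvd by simp
    then show False by auto
  next
    case False
    then have "p > 2" using prime_ge_2_nat[OF \<open>prime p\<close>] by simp
    have "(2 * u - 1)^2 - 5 = 4 * (u * u - u - 1)"
      by (simp add: power2_eq_square algebra_simps)
    then have "int p dvd (2 * u - 1)^2 - 5"
      by (metis dvd dvd_mult)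
    then have "QuadRes (int p) 5"
      unfolding QuadRes_def cong_iff_dvd_diff by blast
    then show False using not_QuadRes_5[OF \<open>prime p\<close> \<open>p > 2\<close> p5] by simp
  qed
qed

text \<open>The quadratic form is the determinant of one block of a codeword. If c is nonzero,
  division by c^2 would make d / c a root of X^2 - X - 1.\<close>

lemma block_det_eq_0_imp:
  fixes c d :: "'p::prime_card mod_ring"
  assumes p5: "[CARD('p) = 2] (mod 5) \<or> [CARD('p) = 3] (mod 5)"
    and eq: "d * d - c * (c + d) = 0"
  shows "c = 0 \<and> d = 0"
proof (cases "c = 0")
  case True
  then show ?thesis using eq by simp
next
  case False
  define u where "u = d / c"
  have "d = u * c" using False by (simp add: u_def)
  then have "(u * u - u - 1) * (c * c) = 0" using eq by (simp add: algebra_simps)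
  then have u: "u * u - u - 1 = 0" using False by simp
  \<comment> \<open>An integer representative of the root brings the equation back to divisibility
    by p.\<close>
  define k where "k = to_int_mod_ring u"
  have "u = of_int k"
    by (simp add: k_def of_int_of_int_mod_ring)
  then have "of_int (k * k - k - 1) = (of_int 0 :: 'p mod_ring)"
    using u by simp
  then have "int CARD('p) dvd k * k - k - 1"
    unfolding of_int_eq_iff_cong_CHAR by (simp add: cong_0_iff)
  then show ?thesis using golden_poly_no_root_mod[OF prime_card p5] by blast
qed

section \<open>The prime field inside the field with p^2 elements, and coordinates\<close>

context
  fixes t :: "'k::field itself"
  assumes card_k: "CARD('k) = CARD('p::prime_card)\<^sup>2"
begin

text \<open>The characteristic of a finite field is a prime dividing its number of elements, here
  p^2.\<close>

lemma CHAR_eq_card: "CHAR('k) = CARD('p)"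
proof -
  have "finite (UNIV :: 'k set)"
    using card_k by (intro card_ge_0_finite) simp
  then have "CHAR('k) > 0" by (rule finite_imp_CHAR_pos)
  then have "prime CHAR('k)" by (rule prime_CHAR_semidom)
  moreover have "CHAR('k) dvd CARD('p)\<^sup>2"
    using CHAR_dvd_CARD[where 'a='k] card_k by simp
  ultimately show ?thesis
    using prime_card[where 'a='p] by (meson prime_dvd_power primes_dvd_imp_eq)
qed

text \<open>Integer representatives add up only modulo p; characteristic p absorbs the
  reduction.\<close>

lemma emb_add: "(emb (a + b :: 'p mod_ring) :: 'k) = emb a + emb b"
  unfolding emb_def to_int_mod_ring_add
  by (simp flip: CHAR_eq_card)

lemma emb_mult: "(emb (a * b :: 'p mod_ring) :: 'k) = emb a * emb b"
  unfolding emb_def to_int_mod_ring_mult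
  by (simp flip: CHAR_eq_card)

lemma emb_1 [simp]: "(emb (1 :: 'p mod_ring) :: 'k) = 1"
  by (simp add: emb_def)

lemma module_ext_scale: "Modules.module (ext_scale :: 'p mod_ring \<Rightarrow> 'k \<Rightarrow> 'k)"
  by unfold_locales (auto simp: ext_scale_def emb_add emb_mult algebra_simps)

text \<open>Otherwise \<open>{1, \<omega>}\<close> collapses to a singleton, whose span has at most
  p < p^2 elements. Distinctness keeps the two coordinates apart.\<close>

lemma basis_imp_neq_1:
  assumes "is_ext_basis TYPE('p) {1, \<omega> :: 'k}"
  shows "\<omega> \<noteq> 1"
proof
  interpret E: Modules.module "ext_scale :: 'p mod_ring \<Rightarrow> 'k \<Rightarrow> 'k"
    by (rule module_ext_scale)
  assume "\<omega> = 1"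
  then have "E.span {1} = UNIV"
    using assms by (simp add: is_ext_basis_def)
  then have "(UNIV :: 'k set) = range (emb :: 'p mod_ring \<Rightarrow> 'k)"
    unfolding E.span_singleton by (simp add: ext_scale_def)
  then have "CARD('k) \<le> CARD('p)"
    by (metis CARD_mod_ring card_image_le finite)
  moreover have "CARD('p) > 1"
    using prime_card[where 'a='p] prime_gt_1_nat by blast
  ultimately show False
    using card_k by (simp add: power2_eq_square)
qed

text \<open>Representations in an independent set are unique. This provides field elements with
  prescribed coordinates.\<close>

lemma coord_combination:
  fixes \<omega> :: 'k and c d :: "'p mod_ring"
  assumes B: "is_ext_basis TYPE('p) {1, \<omega>}"
  shows "coord \<omega> 1 (emb c + emb d * \<omega>) = c" "coord \<omega> \<omega> (emb c + emb d * \<omega>) = d"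
proof -
  interpret E: Modules.module "ext_scale :: 'p mod_ring \<Rightarrow> 'k \<Rightarrow> 'k"
    by (rule module_ext_scale)
  have ne: "\<omega> \<noteq> 1" using basis_imp_neq_1[OF B] .
  have ind: "E.independent {1, \<omega>}" and sp: "\<And>v. v \<in> E.span {1, \<omega>}"
    using B by (auto simp: is_ext_basis_def)
  have x: "emb c + emb d * \<omega> = ext_scale c 1 + ext_scale d \<omega>"
    by (simp add: ext_scale_def)
  have "E.representation {1, \<omega>} (emb c + emb d * \<omega>)
      = (\<lambda>b. c * (if b = 1 then 1 else 0) + d * (if b = \<omega> then 1 else 0))"
    unfolding x
    by (simp add: E.representation_add[OF ind sp sp] E.representation_scale[OF ind sp]
        E.representation_basis[OF ind])
  then show "coord \<omega> 1 (emb c + emb d * \<omega>) = c" "coord \<omega> \<omega> (emb c + emb d * \<omega>) = d"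
    using ne by (simp_all add: coord_def)
qed

end

section \<open>Full rank from a nonzero minor\<close>

lemma (in vec_space) rank_le_n:
  assumes "A \<in> carrier_mat n nc"
  shows "rank A \<le> n"
proof -
  have sub: "VectorSpace.subspace class_ring (span (set (cols A))) V"
    using assms cols_dim[of A] by (intro span_is_subspace) auto
  show ?thesis
    using subspace_dim[OF sub fin_dim] fin_dim_span_cols[OF assms]
    unfolding rank_def dim_is_n by simp
qed

text \<open>The columns of the nonsingular \<open>B\<close> are n independent vectors among the
  columns of \<open>A\<close>.\<close>

lemma (in vec_space) rank_eq_n_if_minor:
  assumes A: "A \<in> carrier_mat n nc" and B: "B \<in> carrier_mat n n"
    and cols: "set (cols B) \<subseteq> set (cols A)" and det: "det B \<noteq> 0"
  shows "rank A = n"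
proof (rule antisym[OF rank_le_n[OF A]])
  have rB: "rank B = n" using det det_rank_iff[OF B] by simp
  \<comment> \<open>The columns are counted as a set, so a repetition must be excluded; it would
    lower the rank of \<open>B\<close>.\<close>
  have dist: "distinct (cols B)"
    using non_distinct_low_rank[OF B] rB by auto
  have "card (set (cols B)) \<le> rank A"
    using rank_ge_card_indpt[OF A cols full_rank_lin_indpt[OF B rB dist]] .
  then show "n \<le> rank A"
    using distinct_card[OF dist] B by simp
qed

lemma det_2:
  fixes A :: "'a::comm_ring_1 mat"
  assumes A: "A \<in> carrier_mat 2 2"
  shows "det A = A $$ (0, 0) * A $$ (1, 1) - A $$ (0, 1) * A $$ (1, 0)"
proof -
  have minor: "det (mat_delete A 0 j) = mat_delete A 0 j $$ (0, 0)" for j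
    using mat_delete_carrier[OF A, of 0 j] by (intro det_single) simp
  have "det (mat_delete A 0 0) = A $$ (1, 1)" "det (mat_delete A 0 1) = A $$ (1, 0)"
    unfolding minor using A by (simp_all add: mat_delete_def)
  moreover have "det A = (\<Sum>j<2. A $$ (0, j) * cofactor A 0 j)"
    by (rule laplace_expansion_row[OF A]) simp
  ultimately show ?thesis
    by (simp add: cofactor_def numeral_2_eq_2)
qed

section \<open>The code as the image of a linear map\<close>

text \<open>Here \<open>v\<close> interleaves the coordinates as (d_1, c_1, ..., d_r, c_r), which
  turns the code into the image of a space of vectors over the prime field.\<close>

definition block_mat :: "nat \<Rightarrow> 'a::field vec \<Rightarrow> 'a mat" where
  "block_mat r v = mat 2 (2 * r) (\<lambda>(i, j). if i = 0 then v $ j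
     else if even j then v $ (j + 1) + v $ j else v $ (j - 1))"

lemma block_mat_carrier [simp]: "block_mat r v \<in> carrier_mat 2 (2 * r)"
  by (simp add: block_mat_def)

lemma block_mat_diff:
  assumes "v \<in> carrier_vec (2 * r)" "w \<in> carrier_vec (2 * r)"
  shows "block_mat r v - block_mat r w = block_mat r (v - w)"
proof (rule eq_matI)
  fix i j assume "i < dim_row (block_mat r (v - w))" "j < dim_col (block_mat r (v - w))"
  \<comment> \<open>The bottom entry of an even column reads position \<open>j + 1\<close>, which is
    in range because the number of columns is even.\<close>
  moreover from this have "even j \<Longrightarrow> j + 1 < 2 * r"
    by (auto simp: block_mat_def elim!: evenE)
  ultimately show "(block_mat r v - block_mat r w) $$ (i, j) = block_mat r (v - w) $$ (i, j)"
    using assms by (auto simp: block_mat_def)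
qed (auto simp: block_mat_def)

lemma block_mat_add:
  assumes "v \<in> carrier_vec (2 * r)" "w \<in> carrier_vec (2 * r)"
  shows "block_mat r (v + w) = block_mat r v + block_mat r w"
proof (rule eq_matI)
  fix i j assume "i < dim_row (block_mat r v + block_mat r w)" "j < dim_col (block_mat r v + block_mat r w)"
  moreover from this have "even j \<Longrightarrow> j + 1 < 2 * r"
    by (auto simp: block_mat_def elim!: evenE)
  ultimately show "block_mat r (v + w) $$ (i, j) = (block_mat r v + block_mat r w) $$ (i, j)"
    using assms by (auto simp: block_mat_def)
qed (auto simp: block_mat_def)

lemma block_mat_smult:
  assumes "v \<in> carrier_vec (2 * r)"
  shows "block_mat r (a \<cdot>\<^sub>v v) = a \<cdot>\<^sub>m block_mat r v"
proof (rule eq_matI)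
  fix i j assume "i < dim_row (a \<cdot>\<^sub>m block_mat r v)" "j < dim_col (a \<cdot>\<^sub>m block_mat r v)"
  moreover from this have "even j \<Longrightarrow> j + 1 < 2 * r"
    by (auto simp: block_mat_def elim!: evenE)
  ultimately show "block_mat r (a \<cdot>\<^sub>v v) $$ (i, j) = (a \<cdot>\<^sub>m block_mat r v) $$ (i, j)"
    using assms by (auto simp: block_mat_def algebra_simps)
qed (auto simp: block_mat_def)

text \<open>The top row is \<open>v\<close> itself. This gives the trivial kernel and separates
  codewords.\<close>

lemma block_mat_eq_0_iff:
  assumes "v \<in> carrier_vec (2 * r)"
  shows "block_mat r v = 0\<^sub>m 2 (2 * r) \<longleftrightarrow> v = 0\<^sub>v (2 * r)"
proof
  assume eq: "block_mat r v = 0\<^sub>m 2 (2 * r)"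
  show "v = 0\<^sub>v (2 * r)"
  proof (rule eq_vecI)
    fix j assume j: "j < dim_vec (0\<^sub>v (2 * r) :: 'a vec)"
    have "block_mat r v $$ (0, j) = 0" using j by (simp add: eq)
    then show "v $ j = 0\<^sub>v (2 * r) $ j" using j by (simp add: block_mat_def)
  qed (use assms in auto)
next
  assume v: "v = 0\<^sub>v (2 * r)"
  show "block_mat r v = 0\<^sub>m 2 (2 * r)"
    unfolding v
    by (rule eq_matI) (auto simp: block_mat_def elim!: evenE)
qed

lemma block_mat_linear:
  "linear_map class_ring (module_vec TYPE('a::field) (2 * r)) (module_mat TYPE('a) 2 (2 * r))
     (block_mat r)"
proof -
  have "block_mat r \<in> LinearCombinations.module_hom class_ring
      (module_vec TYPE('a) (2 * r)) (module_mat TYPE('a) 2 (2 * r))"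
    unfolding LinearCombinations.module_hom_def module_vec_simps module_mat_simps
    by (simp add: block_mat_add block_mat_smult)
  then show ?thesis
    using vec_vs[where 'a='a] matrix_vs[where 'a='a]
    by (simp add: linear_map_def mod_hom_def mod_hom_axioms_def vectorspace_def)
qed

text \<open>Rank-nullity with trivial kernel: the image has the dimension of the domain.\<close>

lemma subspace_dim_block_mat:
  fixes r :: nat
  defines "C \<equiv> block_mat r ` carrier_vec (2 * r) :: 'a::field mat set"
  shows "VectorSpace.subspace class_ring C (module_mat TYPE('a) 2 (2 * r))"
    and "vectorspace.dim class_ring ((module_mat TYPE('a) 2 (2 * r))\<lparr>carrier := C\<rparr>) = 2 * r"
proof -
  interpret S: vec_space "TYPE('a)" "2 * r" .
  interpret T: linear_map class_ring "module_vec TYPE('a) (2 * r)" "module_mat TYPE('a) 2 (2 * r)"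
    "block_mat r" by (rule block_mat_linear)
  have im: "T.im = C"
    by (simp add: T.im_def C_def module_vec_simps)
  have ker: "T.ker = {0\<^sub>v (2 * r)}"
    by (auto simp: T.ker_def module_vec_simps module_mat_simps block_mat_eq_0_iff)
  show "VectorSpace.subspace class_ring C (module_mat TYPE('a) 2 (2 * r))"
    using T.imT_is_subspace im by simp
  \<comment> \<open>The zero space is the span of the empty set.\<close>
  have "vectorspace.dim class_ring (S.vs {0\<^sub>v (2 * r)}) = 0"
    using S.dim_zero_vs S.span_empty by simp
  then show "vectorspace.dim class_ring ((module_mat TYPE('a) 2 (2 * r))\<lparr>carrier := C\<rparr>) = 2 * r"
    using T.rank_nullity[OF S.fin_dim] unfolding im ker S.dim_is_n by simp
qed

section \<open>Minimum distance\<close>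

lemma rank_block_mat:
  fixes v :: "'p::prime_card mod_ring vec"
  assumes p5: "[CARD('p) = 2] (mod 5) \<or> [CARD('p) = 3] (mod 5)"
    and v: "v \<in> carrier_vec (2 * r)" "v \<noteq> 0\<^sub>v (2 * r)"
  shows "vec_space.rank 2 (block_mat r v) = 2"
proof -
  obtain j where j: "j < 2 * r" "v $ j \<noteq> 0"
    using v by (metis carrier_vecD eq_vecI index_zero_vec)
  \<comment> \<open>The even column that starts the block containing column
    \<open>j\<close>.\<close>
  define s where "s = 2 * (j div 2)"
  have s: "even s" "s + 1 < 2 * r" and js: "j = s \<or> j = s + 1"
    using j(1) unfolding s_def by (simp, presburger, presburger)
  define d where "d = v $ s"
  define c where "c = v $ (s + 1)"
  have cd: "\<not> (c = 0 \<and> d = 0)" using js j(2) by (auto simp: c_def d_def)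
  \<comment> \<open>The block (d, c; c + d, d) cut out of columns \<open>s\<close> and
    \<open>s + 1\<close>.\<close>
  define B where "B = mat 2 2 (\<lambda>(i, l). block_mat r v $$ (i, s + l))"
  have B: "B \<in> carrier_mat 2 2" by (simp add: B_def)
  have "det B = d * d - c * (c + d)"
    using s det_2[OF B] by (simp add: B_def block_mat_def c_def d_def)
  then have det: "det B \<noteq> 0" using block_det_eq_0_imp[OF p5] cd by metis
  have "set (cols B) \<subseteq> set (cols (block_mat r v))"
  proof
    fix x assume "x \<in> set (cols B)"
    then obtain l where l: "l < 2" "x = col B l"
      using B by (auto simp: cols_def)
    have "col B l = col (block_mat r v) (s + l)"
      using l s by (intro eq_vecI) (auto simp: B_def block_mat_def)
    then show "x \<in> set (cols (block_mat r v))"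
      using l s by (auto simp: cols_def block_mat_def)
  qed
  then show ?thesis
    using vec_space.rank_eq_n_if_minor[OF block_mat_carrier B _ det] by blast
qed

text \<open>The difference of two distinct codewords is a nonzero codeword, so all their distances
  equal 2 exactly.\<close>

lemma min_rank_dist_block_mat:
  assumes p5: "[CARD('p::prime_card) = 2] (mod 5) \<or> [CARD('p) = 3] (mod 5)" and "r > 0"
  shows "is_min_rank_dist (block_mat r ` carrier_vec (2 * r) :: 'p mod_ring mat set) 2"
proof -
  have dist: "rank_dist (block_mat r v) (block_mat r w) = 2"
    if vw: "v \<in> carrier_vec (2 * r)" "w \<in> carrier_vec (2 * r)" and ne: "block_mat r v \<noteq> block_mat r w"
    for v w :: "'p mod_ring vec"
  proof -
    have "v - w \<noteq> 0\<^sub>v (2 * r)"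
    proof
      assume "v - w = 0\<^sub>v (2 * r)"
      then have "block_mat r v - block_mat r w = 0\<^sub>m 2 (2 * r)"
        using vw by (simp add: block_mat_diff block_mat_eq_0_iff)
      moreover have "block_mat r v = (block_mat r v - block_mat r w) + block_mat r w"
        by (rule eq_matI) (auto simp: block_mat_def)
      ultimately show False
        using ne by (metis block_mat_carrier left_add_zero_mat)
    qed
    then show ?thesis
      using rank_block_mat[OF p5, of "v - w" r] vw
      by (simp add: rank_dist_def block_mat_diff) (simp add: block_mat_def)
  qed
  \<comment> \<open>Two distinct codewords are needed for the distance to be attained;
    \<open>r > 0\<close> supplies the unit vector.\<close>
  have "unit_vec (2 * r) 0 \<noteq> (0\<^sub>v (2 * r) :: 'p mod_ring vec)"
    using \<open>r > 0\<close> by (metis index_unit_vec(1) index_zero_vec(1) mult_pos_pos zero_less_numeral zero_neq_one)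
  then have ne: "block_mat r (unit_vec (2 * r) 0) \<noteq> block_mat r (0\<^sub>v (2 * r) :: 'p mod_ring vec)"
    by (metis block_mat_eq_0_iff unit_vec_carrier zero_carrier_vec)
  show ?thesis
    unfolding is_min_rank_dist_def
  proof
    show "\<exists>A\<in>block_mat r ` carrier_vec (2 * r). \<exists>B\<in>block_mat r ` carrier_vec (2 * r).
        A \<noteq> (B :: 'p mod_ring mat) \<and> rank_dist A B = 2"
      using ne dist[OF unit_vec_carrier zero_carrier_vec ne]
      by (meson imageI unit_vec_carrier zero_carrier_vec)
  qed (use dist in auto)
qed

section \<open>Identification of the code with the image of \<open>block_mat\<close>\<close>

lemma phi_O_image:
  fixes \<omega> :: "'k::field"
  assumes card_k: "CARD('k) = CARD('p::prime_card)\<^sup>2"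
    and B: "is_ext_basis TYPE('p) {1, \<omega>}"
  shows "(phi_O \<omega> ` carrier_vec r :: 'p mod_ring mat set) = block_mat r ` carrier_vec (2 * r)"
proof (intro equalityI subsetI)
  fix M :: "'p mod_ring mat" assume "M \<in> phi_O \<omega> ` carrier_vec r"
  then obtain x where x: "x \<in> carrier_vec r" "M = phi_O \<omega> x" by auto
  \<comment> \<open>Even positions hold the coefficient of \<omega>, odd positions that of
    1.\<close>
  define v :: "'p mod_ring vec" where
    "v = vec (2 * r) (\<lambda>j. coord \<omega> (if even j then \<omega> else 1) (x $ (j div 2)))"
  have "M = block_mat r v"
    unfolding x(2)
  proof (rule eq_matI)
    fix i j assume "i < dim_row (block_mat r v)" "j < dim_col (block_mat r v)"
    moreover from this have "even j \<Longrightarrow> j + 1 < 2 * r"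
      by (auto simp: block_mat_def elim!: evenE)
    \<comment> \<open>In an odd column the bottom entry comes from position \<open>j - 1\<close>,
      which belongs to the same component of \<open>x\<close>.\<close>
    moreover have "odd j \<Longrightarrow> (j - 1) div 2 = j div 2"
      by (auto elim!: oddE)
    ultimately show "phi_O \<omega> x $$ (i, j) = block_mat r v $$ (i, j)"
      using x(1) by (auto simp: phi_O_def block_mat_def v_def Let_def)
  qed (use x(1) in \<open>auto simp: phi_O_def block_mat_def\<close>)
  then show "M \<in> block_mat r ` carrier_vec (2 * r)"
    by (auto simp: v_def)
next
  fix M :: "'p mod_ring mat" assume "M \<in> block_mat r ` carrier_vec (2 * r)"
  then obtain v where v: "v \<in> carrier_vec (2 * r)" "M = block_mat r v" by auto
  \<comment> \<open>The interleaving is undone: component \<open>t\<close> is c + d\<omega> with c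
    at position \<open>2 * t + 1\<close> and d at \<open>2 * t\<close>.\<close>
  define x :: "'k vec" where
    "x = vec r (\<lambda>t. emb (v $ (2 * t + 1)) + emb (v $ (2 * t)) * \<omega>)"
  have "M = phi_O \<omega> x"
    unfolding v(2)
  proof (rule eq_matI)
    fix i j assume "i < dim_row (phi_O \<omega> x :: 'p mod_ring mat)"
      "j < dim_col (phi_O \<omega> x :: 'p mod_ring mat)"
    then have ij: "i < 2" "j < 2 * r" by (auto simp: phi_O_def x_def)
    define t where "t = j div 2"
    have t: "t < r" "j = 2 * t \<or> j = 2 * t + 1" using ij by (auto simp: t_def)
    note c = coord_combination[OF card_k B, of "v $ (2 * t + 1)" "v $ (2 * t)"]
    from t(2) show "block_mat r v $$ (i, j) = phi_O \<omega> x $$ (i, j)"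
    proof
      assume "j = 2 * t"
      then show ?thesis using ij t(1) c by (simp add: phi_O_def block_mat_def x_def Let_def)
    next
      assume "j = 2 * t + 1"
      then show ?thesis using ij t(1) c by (simp add: phi_O_def block_mat_def x_def Let_def)
    qed
  qed (auto simp: phi_O_def block_mat_def x_def)
  then show "M \<in> phi_O \<omega> ` carrier_vec r"
    by (auto simp: x_def)
qed

theorem mainTheorem2:
  fixes p r :: nat and \<omega> :: "'k::field"
  assumes "prime p"
    and "CARD('p::prime_card) = p"
    and "CARD('k) = p\<^sup>2"
    and "[p = 2] (mod 5) \<or> [p = 3] (mod 5)"
    and "r > 0"
    and "is_ext_basis TYPE('p) {1, \<omega>}"
  shows "mrd_code 2 (2 * r) (phi_O \<omega> ` carrier_vec r :: 'p mod_ring mat set)"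
proof -
  have p5: "[CARD('p) = 2] (mod 5) \<or> [CARD('p) = 3] (mod 5)"
    using assms by simp
  have C: "(phi_O \<omega> ` carrier_vec r :: 'p mod_ring mat set) = block_mat r ` carrier_vec (2 * r)"
    using assms by (intro phi_O_image) simp_all
  have "rank_metric_code 2 (2 * r) (2 * r) 2 (phi_O \<omega> ` carrier_vec r :: 'p mod_ring mat set)"
    unfolding C rank_metric_code_def
    using subspace_dim_block_mat min_rank_dist_block_mat[OF p5 \<open>r > 0\<close>] by blast
  \<comment> \<open>The two bounds are 4r - 2 and 2r; the second is the minimum because r is at
    least 1.\<close>
  moreover have "int (2 * r) = min (int 2 * (int (2 * r) - int 2 + 1)) (int (2 * r) * (int 2 - int 2 + 1))"
    using \<open>r > 0\<close> by simp
  ultimately show ?thesis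
    unfolding mrd_code_def by blast
qed

end
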